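(* Let $G=([n],E)$ be a graph, let $\mathbf p=(p_1,\dots,p_n)$ be a strict vector coloring of $G$, and let $\tilde G(\mathbf p)$ be the tensegrity framework obtained from $G$ by declaring every edge a strut (no bars, no cables) with vectors $p_i$. Then: (i) if $\tilde G(\mathbf p)$ is universally completable, then $\mathbf p$ is the unique optimal vector coloring of $G$ (i.e., every optimal vector coloring $\mathbf q$ satisfies $\mathrm{Gram}(q_1,\dots,q_n)=\mathrm{Gram}(p_1,\dots,p_n)$); (ii) if $\mathbf p$ is optimal as a vector coloring, then $G$ is uniquely vector colorable if and only if $\tilde G(\mathbf p)$ is universally completable.
   Context: For $t\ge2$, a vector $t$-coloring of $G$ is an assignment of real unit vectors $p_i$ with $p_i^Tp_j\le-1/(t-1)$ for all edges $ij$; it is a strict vector $t$-coloring if equality holds on every edge. The vector chromatic number $\chi_v(G)$ is the least $t$ admitting a vector $t$-coloring, and a vector coloring is optimal if it is a vector $\chi_v(G)$-coloring. $G$ is uniquely vector colorable if any two optimal vector colorings have the same Gram matrix $\mathrm{Gram}(p_1,\dots,p_n)=(p_i^Tp_j)_{i,j}$. A tensegrity framework with struts $S$ only: a framework $\tilde G(\mathbf p)$ dominates $\tilde G(\mathbf q)$ (the $q_i$ in a real space of any dimension) if $q_i^Tq_i=p_i^Tp_i$ for all $i$ and $q_i^Tq_j\le p_i^Tp_j$ for all edges $ij$; it is universally completable if every framework it dominates has the same Gram matrix. *)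

theory Defs
  imports Complex_Main "Jordan_Normal_Form.Matrix"
begin

text \<open>
  A graph on \<open>n\<close> vertices has vertex set \<open>{..<n}\<close> and a set of two-element edges.
  An assignment \<open>p\<close> of vectors to the vertices is a function of type \<open>nat \<Rightarrow> real vec\<close>;
  only its values on \<open>{..<n}\<close> are relevant. Since the dimension of a \<open>real vec\<close> is part of its
  value and not of its type, a quantifier over \<open>p\<close> together with \<open>vectors_in n d p\<close> for some \<open>d\<close>
  ranges over assignments into real spaces of every dimension.
\<close>

definition simple_graph :: "nat \<Rightarrow> nat set set \<Rightarrow> bool" where
  "simple_graph n E \<longleftrightarrow> (\<forall>e\<in>E. e \<subseteq> {..<n} \<and> card e = 2)"

definition vectors_in :: "nat \<Rightarrow> nat \<Rightarrow> (nat \<Rightarrow> real vec) \<Rightarrow> bool" where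
  "vectors_in n d p \<longleftrightarrow> (\<forall>i<n. p i \<in> carrier_vec d)"

definition Gram :: "nat \<Rightarrow> (nat \<Rightarrow> real vec) \<Rightarrow> real mat" where
  "Gram n p = mat n n (\<lambda>(i, j). p i \<bullet> p j)"

definition unit_vectors :: "nat \<Rightarrow> (nat \<Rightarrow> real vec) \<Rightarrow> bool" where
  "unit_vectors n p \<longleftrightarrow> (\<exists>d. vectors_in n d p) \<and> (\<forall>i<n. p i \<bullet> p i = 1)"

definition vector_t_coloring ::
    "nat \<Rightarrow> nat set set \<Rightarrow> real \<Rightarrow> (nat \<Rightarrow> real vec) \<Rightarrow> bool" where
  "vector_t_coloring n E t p \<longleftrightarrow>
     t \<ge> 2 \<and> unit_vectors n p \<and> (\<forall>i j. {i, j} \<in> E \<longrightarrow> p i \<bullet> p j \<le> - 1 / (t - 1))"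

definition strict_vector_t_coloring ::
    "nat \<Rightarrow> nat set set \<Rightarrow> real \<Rightarrow> (nat \<Rightarrow> real vec) \<Rightarrow> bool" where
  "strict_vector_t_coloring n E t p \<longleftrightarrow>
     vector_t_coloring n E t p \<and> (\<forall>i j. {i, j} \<in> E \<longrightarrow> p i \<bullet> p j = - 1 / (t - 1))"

definition strict_vector_coloring :: "nat \<Rightarrow> nat set set \<Rightarrow> (nat \<Rightarrow> real vec) \<Rightarrow> bool" where
  "strict_vector_coloring n E p \<longleftrightarrow> (\<exists>t. strict_vector_t_coloring n E t p)"

text \<open>
  The vector chromatic number is the least \<open>t\<close> admitting a vector \<open>t\<close>-coloring. It exists by
  compactness; it is written as an infimum, which agrees with the least element whenever there
  is one (\<open>vector_chromatic_number_eq_least\<close>). As \<open>t \<ge> 2\<close> is part of being a vector \<open>t\<close>-coloring,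
  an edgeless graph has vector chromatic number 2.
\<close>

definition vector_chromatic_number :: "nat \<Rightarrow> nat set set \<Rightarrow> real" where
  "vector_chromatic_number n E = Inf {t. \<exists>p. vector_t_coloring n E t p}"

lemma vector_chromatic_number_eq_least:
  assumes "vector_t_coloring n E t p"
    and "\<And>s q. vector_t_coloring n E s q \<Longrightarrow> t \<le> s"
  shows "vector_chromatic_number n E = t"
  unfolding vector_chromatic_number_def
  by (rule cInf_eq_minimum) (use assms in auto)

definition optimal_vector_coloring :: "nat \<Rightarrow> nat set set \<Rightarrow> (nat \<Rightarrow> real vec) \<Rightarrow> bool" where
  "optimal_vector_coloring n E p \<longleftrightarrow>
     vector_t_coloring n E (vector_chromatic_number n E) p"

definition unique_optimal_vector_coloring ::
    "nat \<Rightarrow> nat set set \<Rightarrow> (nat \<Rightarrow> real vec) \<Rightarrow> bool" where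
  "unique_optimal_vector_coloring n E p \<longleftrightarrow>
     optimal_vector_coloring n E p \<and>
     (\<forall>q. optimal_vector_coloring n E q \<longrightarrow> Gram n q = Gram n p)"

definition uniquely_vector_colorable :: "nat \<Rightarrow> nat set set \<Rightarrow> bool" where
  "uniquely_vector_colorable n E \<longleftrightarrow>
     (\<forall>p q. optimal_vector_coloring n E p \<longrightarrow> optimal_vector_coloring n E q \<longrightarrow>
        Gram n p = Gram n q)"

text \<open>
  A tensegrity framework without bars and cables is given by the number \<open>n\<close> of vertices, the set
  \<open>S\<close> of struts and the vector assignment \<open>p\<close>. The assignments \<open>p\<close> and \<open>q\<close> may
  live in different dimensions.
\<close>

definition strut_dominates ::
    "nat \<Rightarrow> nat set set \<Rightarrow> (nat \<Rightarrow> real vec) \<Rightarrow> (nat \<Rightarrow> real vec) \<Rightarrow> bool" where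
  "strut_dominates n S p q \<longleftrightarrow>
     (\<forall>i<n. q i \<bullet> q i = p i \<bullet> p i) \<and> (\<forall>i j. {i, j} \<in> S \<longrightarrow> q i \<bullet> q j \<le> p i \<bullet> p j)"

definition strut_universally_completable ::
    "nat \<Rightarrow> nat set set \<Rightarrow> (nat \<Rightarrow> real vec) \<Rightarrow> bool" where
  "strut_universally_completable n S p \<longleftrightarrow>
     (\<forall>d q. vectors_in n d q \<longrightarrow> strut_dominates n S p q \<longrightarrow> Gram n q = Gram n p)"

end

theory Submission
  imports Defs
begin

text \<open>
  The bound \<open>- 1 / (t - 1)\<close> increases with \<open>t\<close>, so if \<open>p\<close> is strict with parameter \<open>t\<close>, the framework
  of \<open>p\<close> dominates every vector \<open>s\<close>-coloring with \<open>s \<le> t\<close>. Under universal completability such a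
  coloring has the Gram matrix of \<open>p\<close>, and reading off one edge entry forces \<open>s = t\<close>; hence \<open>t\<close> is
  the vector chromatic number. Conversely, whatever an optimal vector coloring dominates is again
  an optimal vector coloring.
\<close>

lemma strict_vector_coloring_dominates:
  assumes "strict_vector_t_coloring n E t p" "vector_t_coloring n E s q" "s \<le> t"
  shows "strut_dominates n E p q"
proof -
  \<comment> \<open>From \<open>2 \<le> s\<close> and \<open>s \<le> t\<close> both denominators are
    positive, so the quotients compare as \<open>s\<close> and \<open>t\<close> do.\<close>
  have "- 1 / (s - 1) \<le> - 1 / (t - 1)"
    using assms(2,3) by (simp add: vector_t_coloring_def divide_left_mono)
  moreover have "q i \<bullet> q j \<le> - 1 / (s - 1)" "p i \<bullet> p j = - 1 / (t - 1)" if "{i, j} \<in> E" for i j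
    using assms(1,2) that unfolding strict_vector_t_coloring_def vector_t_coloring_def by blast+
  ultimately have "q i \<bullet> q j \<le> p i \<bullet> p j" if "{i, j} \<in> E" for i j
    using that by fastforce
  moreover have "q i \<bullet> q i = p i \<bullet> p i" if "i < n" for i
    using assms(1,2) that
    by (simp add: strict_vector_t_coloring_def vector_t_coloring_def unit_vectors_def)
  ultimately show ?thesis
    unfolding strut_dominates_def by blast
qed

lemma strut_dominates_vector_t_coloring:
  assumes "vector_t_coloring n E t p" "vectors_in n d q" "strut_dominates n E p q"
  shows "vector_t_coloring n E t q"
proof -
  have "q i \<bullet> q j \<le> - 1 / (t - 1)" if "{i, j} \<in> E" for i j
  proof -
    have "q i \<bullet> q j \<le> p i \<bullet> p j"
      using assms(3) that unfolding strut_dominates_def by blast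
    also have "\<dots> \<le> - 1 / (t - 1)"
      using assms(1) that unfolding vector_t_coloring_def by blast
    finally show ?thesis .
  qed
  moreover have "unit_vectors n q"
    using assms unfolding unit_vectors_def vector_t_coloring_def strut_dominates_def by auto
  ultimately show ?thesis
    using assms(1) unfolding vector_t_coloring_def by blast
qed

lemma Gram_eqD:
  assumes "Gram n q = Gram n p" "i < n" "j < n"
  shows "q i \<bullet> q j = p i \<bullet> p j"
proof -
  have "Gram n q $$ (i, j) = Gram n p $$ (i, j)"
    using assms(1) by simp
  then show ?thesis
    using assms(2,3) by (simp add: Gram_def)
qed

text \<open>Serves the edgeless case, where strictness is vacuous and does not pin down
  \<open>t\<close>. The value 2 is the lower bound built into \<open>vector_t_coloring\<close>, and
  \<open>p\<close> attains it.\<close>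

lemma vector_chromatic_number_no_edges:
  assumes "unit_vectors n p"
  shows "vector_chromatic_number n {} = 2"
  by (rule vector_chromatic_number_eq_least[of n "{}" 2 p])
    (use assms in \<open>auto simp: vector_t_coloring_def\<close>)

lemma strut_universally_completable_Gram_eq:
  assumes "strut_universally_completable n E p" "strict_vector_t_coloring n E t p"
    and "vector_t_coloring n E s q" "s \<le> t"
  shows "Gram n q = Gram n p"
  using strict_vector_coloring_dominates[OF assms(2-4)] assms(1,3)
  unfolding strut_universally_completable_def vector_t_coloring_def unit_vectors_def by blast

text \<open>An edge entry of the common Gram matrix equals \<open>- 1 / (t - 1)\<close> and is at
  most \<open>- 1 / (s - 1)\<close>; as \<open>s\<close> and \<open>t\<close> are at least 2,
  clearing the positive denominators gives the bound.\<close>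

lemma strict_vector_coloring_param_le:
  assumes "simple_graph n E" "E \<noteq> {}" "strict_vector_t_coloring n E t p"
    and "vector_t_coloring n E s q" "Gram n q = Gram n p"
  shows "t \<le> s"
proof -
  obtain e where "e \<in> E"
    using assms(2) by blast
  then obtain i j where ij: "{i, j} \<in> E" "i < n" "j < n"
    using assms(1) by (auto simp: simple_graph_def card_2_iff)
  have "- 1 / (t - 1) = q i \<bullet> q j"
    using Gram_eqD[OF assms(5) ij(2,3)] assms(3) ij(1) by (simp add: strict_vector_t_coloring_def)
  also have "\<dots> \<le> - 1 / (s - 1)"
    using assms(4) ij(1) by (simp add: vector_t_coloring_def)
  finally show ?thesis
    using assms(3,4)
    by (auto simp: strict_vector_t_coloring_def vector_t_coloring_def field_simps)
qed

lemma strut_universally_completable_imp_unique_optimal: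
  assumes graph: "simple_graph n E"
    and strict: "strict_vector_t_coloring n E t p"
    and compl: "strut_universally_completable n E p"
  shows "unique_optimal_vector_coloring n E p"
proof -
  have col: "vector_t_coloring n E t p"
    using strict by (simp add: strict_vector_t_coloring_def)
  \<comment> \<open>Only an inequality: without edges \<open>t\<close> can be any real at least 2
    and may exceed the chromatic number.\<close>
  have "vector_chromatic_number n E \<le> t \<and> optimal_vector_coloring n E p"
  proof (cases "E = {}")
    case True
    then show ?thesis
      using col vector_chromatic_number_no_edges[of n p]
      by (simp add: optimal_vector_coloring_def vector_t_coloring_def)
  next
    case False
    \<comment> \<open>Only \<open>s < t\<close> needs an argument; there completability equates the
      Gram matrices, and an edge entry gives a contradiction.\<close>
    have "t \<le> s" if "vector_t_coloring n E s q" for s q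
      using strict_vector_coloring_param_le[OF graph False strict that]
        strut_universally_completable_Gram_eq[OF compl strict that] by linarith
    then have "vector_chromatic_number n E = t"
      by (rule vector_chromatic_number_eq_least[OF col])
    then show ?thesis
      using col by (simp add: optimal_vector_coloring_def)
  qed
  \<comment> \<open>Take \<open>s\<close> to be the chromatic number, which is at most
    \<open>t\<close>.\<close>
  then show ?thesis
    using strut_universally_completable_Gram_eq[OF compl strict]
    unfolding unique_optimal_vector_coloring_def optimal_vector_coloring_def by blast
qed

lemma uniquely_vector_colorable_imp_strut_universally_completable:
  assumes "optimal_vector_coloring n E p" "uniquely_vector_colorable n E"
  shows "strut_universally_completable n E p"
  using assms strut_dominates_vector_t_coloring
  unfolding strut_universally_completable_def uniquely_vector_colorable_def
    optimal_vector_coloring_def by blast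

theorem theorem4p6:
  fixes n :: nat and E :: "nat set set" and p :: "nat \<Rightarrow> real vec"
  assumes "simple_graph n E"
    and "strict_vector_coloring n E p"
  shows "(strut_universally_completable n E p \<longrightarrow> unique_optimal_vector_coloring n E p) \<and>
    (optimal_vector_coloring n E p \<longrightarrow>
       (uniquely_vector_colorable n E \<longleftrightarrow> strut_universally_completable n E p))"
proof -
  have unique: "unique_optimal_vector_coloring n E p" if "strut_universally_completable n E p"
    using assms that strut_universally_completable_imp_unique_optimal
    unfolding strict_vector_coloring_def by blast
  \<comment> \<open>Any two optimal colorings share the Gram matrix of \<open>p\<close>.\<close>
  moreover have "uniquely_vector_colorable n E" if "strut_universally_completable n E p"
    using unique[OF that]
    unfolding unique_optimal_vector_coloring_def uniquely_vector_colorable_def by metis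
  ultimately show ?thesis
    using uniquely_vector_colorable_imp_strut_universally_completable by blast
qed

end
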